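(* Let $\Omega\in\mathbb{R}^{n\times r}$ be a test matrix of full rank and let $$H^{\mathrm{Nys}}\langle\Omega\rangle=(H\Omega)(\Omega^*H\Omega)^+(H\Omega)^*$$ be the Nyström approximation of $H\in\mathbb{H}^n_+$ (whose Hermitian square root is denoted by $H^{1/2}$). Then $X^\star=(\Omega^*H\Omega)^+$ is found as the minimiser of the following problem, where $Y=H\Omega$: $$\text{minimise over } X\in\mathbb{H}^r\quad \big\|(H^{1/2})^+\,(H-YXY^* )\,(H^{1/2})^+\big\|_F^2.$$
   Context: $\mathbb{H}^r$ denotes the space of Hermitian $r\times r$ matrices and $\mathbb{H}^n_+$ the cone of Hermitian positive semidefinite $n\times n$ matrices. $M^*$ is the conjugate transpose of $M$, $M^+$ its Moore–Penrose inverse, and $\|\cdot\|_F$ the Frobenius norm.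
   Formalization: Read as a unique minimiser the claim fails (H = 0: every Hermitian X is a minimiser); it is proved that X* is always a minimiser, and that it is the unique one when Ω*HΩ is invertible, which is exactly when uniqueness holds. *)

theory Defs
  imports "HOL-Analysis.Analysis"
begin

text \<open>
  An \<open>m \<times> n\<close> complex matrix is an element of \<^typ>\<open>complex^'n^'m\<close> (columns indexed by \<open>'n\<close>,
  rows by \<open>'m\<close>).
\<close>

definition ctranspose :: "complex^'n^'m \<Rightarrow> complex^'m^'n" where
  "ctranspose A = map_matrix cnj (transpose A)"

definition hermitian :: "complex^'n^'n \<Rightarrow> bool" where
  "hermitian A \<longleftrightarrow> ctranspose A = A"

text \<open>For Hermitian \<open>A\<close> the number \<open>x\<^sup>* A x\<close> is real, so taking \<^const>\<open>Re\<close> loses nothing.\<close>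

definition hermitian_psd :: "complex^'n^'n \<Rightarrow> bool" where
  "hermitian_psd A \<longleftrightarrow>
     hermitian A \<and> (\<forall>x. 0 \<le> Re (\<Sum>i\<in>UNIV. cnj (x $ i) * (A *v x) $ i))"

text \<open>The square root of a Hermitian positive semidefinite matrix; it exists and is unique.\<close>

definition psd_sqrt :: "complex^'n^'n \<Rightarrow> complex^'n^'n" where
  "psd_sqrt A = (THE S. hermitian_psd S \<and> S ** S = A)"

text \<open>
  The Moore--Penrose inverse, given by the four Penrose conditions; every matrix has exactly one.
\<close>

definition is_moore_penrose :: "complex^'n^'m \<Rightarrow> complex^'m^'n \<Rightarrow> bool" where
  "is_moore_penrose A X \<longleftrightarrow>
     A ** X ** A = A \<and> X ** A ** X = X \<and> hermitian (A ** X) \<and> hermitian (X ** A)"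

definition pinv :: "complex^'n^'m \<Rightarrow> complex^'m^'n" where
  "pinv A = (THE X. is_moore_penrose A X)"

definition frobenius_norm :: "complex^'n^'m \<Rightarrow> real" where
  "frobenius_norm A = sqrt (\<Sum>i\<in>UNIV. \<Sum>j\<in>UNIV. (cmod (A $ i $ j))\<^sup>2)"

definition complex_matrix :: "real^'n^'m \<Rightarrow> complex^'n^'m" where
  "complex_matrix A = map_matrix complex_of_real A"

definition nystrom :: "complex^'n^'n \<Rightarrow> complex^'r^'n \<Rightarrow> complex^'n^'n" where
  "nystrom H \<Omega> = (H ** \<Omega>) ** pinv (ctranspose \<Omega> ** H ** \<Omega>) ** ctranspose (H ** \<Omega>)"

definition nystrom_objective ::
  "complex^'n^'n \<Rightarrow> complex^'r^'n \<Rightarrow> complex^'r^'r \<Rightarrow> real" where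
  "nystrom_objective H Y X =
     (frobenius_norm
       (pinv (psd_sqrt H) ** (H - Y ** X ** ctranspose Y) ** pinv (psd_sqrt H)))\<^sup>2"

end

theory Submission
  imports Defs
begin

text \<open>
  Write \<open>S = H\<^sup>1\<^sup>/\<^sup>2\<close>, \<open>A = S \<Omega>\<close> and \<open>G = S S\<^sup>+\<close>, the orthogonal projection onto the range of
  \<open>S\<close>. Since \<open>S\<close> is Hermitian it commutes with \<open>S\<^sup>+\<close>, so \<open>S\<^sup>+ H S\<^sup>+ = G\<close> and \<open>S\<^sup>+ Y = G A = A\<close>.
  The objective is therefore \<open>\<parallel>G - A X A\<^sup>*\<parallel>\<^sup>2\<close> (lemma \<open>nystrom_objective_eq\<close>), a linear
  least-squares problem in \<open>X\<close> whose Gram matrix is \<open>A\<^sup>* A = \<Omega>\<^sup>* H \<Omega>\<close>.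

  With \<open>X\<^sub>s = (A\<^sup>* A)\<^sup>+\<close> the matrix \<open>A X\<^sub>s A\<^sup>*\<close> is the orthogonal projection onto the range of
  \<open>A\<close>. The residual \<open>G - A X\<^sub>s A\<^sup>*\<close> is Hermitian and annihilates \<open>A\<close>, hence it is orthogonal to
  every matrix \<open>A Z A\<^sup>*\<close>. Pythagoras (lemma \<open>gram_least_squares\<close>) gives
    \<open>\<parallel>G - A X A\<^sup>*\<parallel>\<^sup>2 = \<parallel>G - A X\<^sub>s A\<^sup>*\<parallel>\<^sup>2 + \<parallel>A (X\<^sub>s - X) A\<^sup>*\<parallel>\<^sup>2\<close>,
  which shows that \<open>X\<^sub>s\<close> is a minimiser, and the only one if \<open>A\<^sup>* A\<close> is invertible, because then
  \<open>A Z A\<^sup>* = 0\<close> forces \<open>Z = 0\<close>.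

  Square roots and Moore--Penrose inverses are given by definite descriptions, so both need
  existence and uniqueness. Existence is what the spectral theorem is usually quoted for. Here
  an induction principle for positive semidefinite matrices (lemma \<open>hermitian_psd_induct\<close>)
  takes its place: every such matrix arises from \<open>0\<close> by repeatedly adding \<open>\<lambda> E\<close>, where \<open>\<lambda> > 0\<close> and
  \<open>E\<close> is an orthogonal projection that annihilates, and is annihilated by, the matrix built so far.
  A square root grows by \<open>\<surd>\<lambda> E\<close> in each step, a Moore--Penrose inverse by \<open>\<lambda>\<^sup>-\<^sup>1 E\<close>.

  The real part of the complex inner product is the real inner product of the Euclidean spaces
  \<^typ>\<open>complex^'n\<close> and \<^typ>\<open>complex^'n^'m\<close>, and the norm of the latter is the Frobenius norm. All
  orthogonality arguments are carried out with this real inner product, for which the conjugate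
  transpose is still the adjoint.
\<close>

section \<open>Conjugate transpose and the real inner product\<close>

lemma ctranspose_nth: "ctranspose A $ i $ j = cnj (A $ j $ i)"
  by (simp add: ctranspose_def map_matrix_def transpose_def)

lemma ctranspose_ctranspose: "ctranspose (ctranspose A) = A"
  by (simp add: vec_eq_iff ctranspose_nth)

lemma ctranspose_mult: "ctranspose (A ** B) = ctranspose B ** ctranspose A"
  by (simp add: vec_eq_iff ctranspose_nth matrix_matrix_mult_def mult.commute)

lemma ctranspose_0: "ctranspose 0 = 0"
  by (simp add: vec_eq_iff ctranspose_nth)

lemma ctranspose_add: "ctranspose (A + B) = ctranspose A + ctranspose B"
  by (simp add: vec_eq_iff ctranspose_nth)

lemma ctranspose_diff: "ctranspose (A - B) = ctranspose A - ctranspose B"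
  by (simp add: vec_eq_iff ctranspose_nth)

lemma ctranspose_scaleR: "ctranspose (c *\<^sub>R A) = c *\<^sub>R ctranspose A"
  by (simp add: vec_eq_iff ctranspose_nth)

lemma ctranspose_mat_1: "ctranspose (mat 1) = mat 1"
  by (auto simp: vec_eq_iff ctranspose_nth mat_def)

lemma hermitian_ctranspose: "hermitian A \<Longrightarrow> ctranspose A = A"
  by (simp add: hermitian_def)

lemma hermitian_add: "hermitian A \<Longrightarrow> hermitian B \<Longrightarrow> hermitian (A + B)"
  by (simp add: hermitian_def ctranspose_add)

lemma hermitian_diff: "hermitian A \<Longrightarrow> hermitian B \<Longrightarrow> hermitian (A - B)"
  by (simp add: hermitian_def ctranspose_diff)

lemma hermitian_scaleR: "hermitian A \<Longrightarrow> hermitian (c *\<^sub>R A)"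
  by (simp add: hermitian_def ctranspose_scaleR)

lemma hermitian_mat_1: "hermitian (mat 1)"
  by (simp add: hermitian_def ctranspose_mat_1)

lemma matrix_add_rdistrib: "(B + C) ** A = B ** A + C ** A"
  for A :: "complex^'n^'m"
  by (simp add: vec_eq_iff matrix_matrix_mult_def distrib_right sum.distrib)

lemma matrix_diff_ldistrib: "A ** (B - C) = A ** B - A ** C"
  for A :: "complex^'n^'m"
  by (simp add: vec_eq_iff matrix_matrix_mult_def right_diff_distrib sum_subtractf)

lemma matrix_diff_rdistrib: "(B - C) ** A = B ** A - C ** A"
  for A :: "complex^'n^'m"
  by (simp add: vec_eq_iff matrix_matrix_mult_def left_diff_distrib sum_subtractf)

lemma matrix_mult_scaleR_left: "(c *\<^sub>R A) ** B = c *\<^sub>R (A ** B)"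
  for A :: "complex^'n^'m"
  by (simp add: vec_eq_iff matrix_matrix_mult_def scaleR_sum_right)

lemma matrix_mult_scaleR_right: "A ** (c *\<^sub>R B) = c *\<^sub>R (A ** B)"
  for A :: "complex^'n^'m"
  by (simp add: vec_eq_iff matrix_matrix_mult_def scaleR_sum_right)

lemma matrix_vector_scaleR_left: "(c *\<^sub>R A) *v x = c *\<^sub>R (A *v x)"
  for A :: "complex^'n^'m"
  by (simp add: vec_eq_iff matrix_vector_mult_def scaleR_sum_right)

lemma matrix_vector_scaleR_right: "A *v (c *\<^sub>R x) = c *\<^sub>R (A *v x)"
  for A :: "complex^'n^'m"
  by (simp add: vec_eq_iff matrix_vector_mult_def scaleR_sum_right)

text \<open>
  This is the bridge from the sums \<open>x\<^sup>* y\<close> over complex entries to the real inner product.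
\<close>

lemma inner_complex_cnj: "inner x y = Re (cnj x * y)"
  by (simp add: inner_complex_def)

lemma inner_matrix_vector: "inner (A *v x) y = inner x (ctranspose A *v y)"
  for A :: "complex^'n^'m"
proof -
  have entry: "cnj ((A *v x) $ i) * y $ i = (\<Sum>j\<in>UNIV. cnj (A $ i $ j) * cnj (x $ j) * y $ i)" for i
    by (simp add: matrix_vector_mult_def sum_distrib_right)
  have "inner (A *v x) y = (\<Sum>i\<in>UNIV. \<Sum>j\<in>UNIV. Re (cnj (A $ i $ j) * cnj (x $ j) * y $ i))"
    unfolding inner_vec_def inner_complex_cnj entry Re_sum ..
  also have "\<dots> = (\<Sum>j\<in>UNIV. \<Sum>i\<in>UNIV. Re (cnj (A $ i $ j) * cnj (x $ j) * y $ i))"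
    by (rule sum.swap)
  also have "\<dots> = inner x (ctranspose A *v y)"
    unfolding inner_vec_def inner_complex_cnj
    by (simp add: matrix_vector_mult_def ctranspose_nth sum_distrib_left algebra_simps)
  finally show ?thesis .
qed

lemma inner_matrix_columns: "inner A B = (\<Sum>j\<in>UNIV. inner (column j A) (column j B))"
  for A :: "complex^'n^'m"
  unfolding inner_vec_def column_def by (simp add: sum.swap[of _ "UNIV::'n set"])

lemma column_matrix_mult: "column j (A ** B) = A *v column j B"
  by (simp add: vec_eq_iff column_def matrix_matrix_mult_def matrix_vector_mult_def)

text \<open>
  Left multiplication by \<open>A\<close> acts on each column separately, so its adjoint on matrices is again
  left multiplication by \<open>A\<^sup>*\<close>.
\<close>

lemma inner_matrix_mult: "inner (A ** B) C = inner B (ctranspose A ** C)"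
  for A :: "complex^'n^'m"
  by (simp add: inner_matrix_columns column_matrix_mult inner_matrix_vector)

lemma inner_ctranspose: "inner (ctranspose A) (ctranspose B) = inner B A"
  for A :: "complex^'n^'m"
  unfolding inner_vec_def
  by (subst sum.swap) (simp add: ctranspose_nth inner_complex_def mult.commute)

lemma gram_eq_0: "ctranspose A ** A = 0 \<Longrightarrow> A = 0"
  for A :: "complex^'n^'m"
proof -
  assume "ctranspose A ** A = 0"
  then have "inner (A ** mat 1) A = 0"
    by (simp only: inner_matrix_mult) simp
  then show ?thesis by simp
qed

lemma frobenius_norm_eq_norm: "frobenius_norm A = norm A"
  by (simp add: frobenius_norm_def norm_vec_def L2_set_def sum_nonneg)

section \<open>Positive semidefinite matrices\<close>

lemma hermitian_psd_inner: "hermitian_psd A \<longleftrightarrow> hermitian A \<and> (\<forall>x. 0 \<le> inner x (A *v x))"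
  by (simp add: hermitian_psd_def inner_vec_def inner_complex_cnj)

lemma hermitian_psd_hermitian: "hermitian_psd A \<Longrightarrow> hermitian A"
  by (simp add: hermitian_psd_def)

lemma hermitian_psd_congruence:
  fixes A :: "complex^'n^'n" and B :: "complex^'m^'n"
  assumes "hermitian_psd A"
  shows "hermitian_psd (ctranspose B ** A ** B)"
proof -
  have "inner x ((ctranspose B ** A ** B) *v x) = inner (B *v x) (A *v (B *v x))" for x
    by (simp add: inner_matrix_vector matrix_vector_mul_assoc matrix_mul_assoc)
  with assms show ?thesis
    by (simp add: hermitian_psd_inner hermitian_def ctranspose_mult ctranspose_ctranspose
        matrix_mul_assoc)
qed

lemma hermitian_psd_mat_1: "hermitian_psd (mat 1)"
  by (simp add: hermitian_psd_inner hermitian_mat_1)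

lemma hermitian_psd_gram: "hermitian_psd (ctranspose A ** A)"
  using hermitian_psd_congruence[OF hermitian_psd_mat_1, of A] by simp

lemma hermitian_psd_projection: "hermitian E \<Longrightarrow> E ** E = E \<Longrightarrow> hermitian_psd E"
  by (metis hermitian_ctranspose hermitian_psd_gram)

lemma hermitian_psd_add: "hermitian_psd A \<Longrightarrow> hermitian_psd B \<Longrightarrow> hermitian_psd (A + B)"
  by (simp add: hermitian_psd_inner hermitian_add matrix_vector_mult_add_rdistrib inner_add_right)

lemma hermitian_psd_scaleR: "0 \<le> c \<Longrightarrow> hermitian_psd A \<Longrightarrow> hermitian_psd (c *\<^sub>R A)"
  by (simp add: hermitian_psd_inner hermitian_scaleR matrix_vector_scaleR_left)

text \<open>
  If \<open>y = A x\<close> were nonzero, the quadratic form would have the value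
  \<open>-2 s \<parallel>y\<parallel>\<^sup>2 + O(s\<^sup>2)\<close> at \<open>x - s y\<close>, which is negative for small \<open>s > 0\<close>.
\<close>

lemma psd_kernel:
  fixes A :: "complex^'n^'n"
  assumes psd: "hermitian_psd A" and zero: "inner x (A *v x) = 0"
  shows "A *v x = 0"
proof (rule ccontr)
  assume ne: "A *v x \<noteq> 0"
  define y where "y = A *v x"
  define c where "c = inner y (A *v y)"
  \<comment> \<open>Any \<open>s > 0\<close> with \<open>s c < 2 \<parallel>y\<parallel>\<^sup>2\<close> would do; the \<open>+ 1\<close> keeps the quotient defined if \<open>c = 0\<close>.\<close>
  define s where "s = inner y y / (c + 1)"
  have c: "0 \<le> c" and pos: "0 < inner y y"
    using psd ne by (auto simp: hermitian_psd_inner c_def y_def)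
  then have s: "0 < s" by (simp add: s_def)
  have sym: "inner x (A *v y) = inner y y"
    using psd inner_matrix_vector[of A x y] by (simp add: hermitian_psd_inner hermitian_def y_def)
  have "0 \<le> inner (x - s *\<^sub>R y) (A *v (x - s *\<^sub>R y))"
    using psd by (simp add: hermitian_psd_inner)
  also have "\<dots> = s * (s * c) - 2 * (s * inner y y)"
    using zero by (simp add: matrix_vector_mult_diff_distrib matrix_vector_scaleR_right
        inner_diff_left inner_diff_right sym c_def y_def[symmetric] algebra_simps)
  also have "\<dots> = s * (s * c - 2 * inner y y)"
    by (simp add: algebra_simps)
  finally have "2 * inner y y \<le> s * c"
    using s by (simp add: zero_le_mult_iff)
  also have "\<dots> \<le> s * (c + 1)" using s by simp
  also have "\<dots> = inner y y" using c by (simp add: s_def)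
  finally show False using pos by simp
qed

lemma matrix_eq_0_iff: "A = 0 \<longleftrightarrow> (\<forall>x. A *v x = 0)"
  for A :: "complex^'n^'m"
  by (simp add: matrix_eq)

text \<open>
  The witness is \<open>E = v v\<^sup>*\<close>, and \<open>A E = (A v) v\<^sup>*\<close>. These four properties are all that is needed of
  it, so its entries do not occur again.
\<close>

lemma exists_rank_one_projection:
  fixes v :: "complex^'n"
  assumes "norm v = 1"
  obtains E :: "complex^'n^'n"
  where "hermitian E" "E ** E = E" "E *v v = v"
    "\<And>A::complex^'n^'n. \<And>c. A *v v = c *\<^sub>R v \<Longrightarrow> A ** E = c *\<^sub>R E"
proof
  define E :: "complex^'n^'n" where "E = (\<chi> i j. v $ i * cnj (v $ j))"
  show "hermitian E"
    by (simp add: hermitian_def vec_eq_iff ctranspose_nth E_def)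
  have "(\<Sum>j\<in>UNIV. cnj (v $ j) * v $ j) = of_real ((norm v)\<^sup>2)"
    by (simp add: norm_vec_def L2_set_def sum_nonneg complex_norm_square mult.commute del: of_real_power)
  then have one: "(\<Sum>j\<in>UNIV. cnj (v $ j) * v $ j) = 1" using assms by simp
  show Ev: "E *v v = v"
    by (simp add: vec_eq_iff E_def matrix_vector_mult_def mult.assoc sum_distrib_left[symmetric] one)
  show scale: "A ** E = c *\<^sub>R E" if "A *v v = c *\<^sub>R v" for A :: "complex^'n^'n" and c
    using that
    by (simp add: vec_eq_iff E_def matrix_vector_mult_def matrix_matrix_mult_def
        mult.assoc[symmetric] sum_distrib_right[symmetric])
  show "E ** E = E" using scale[of E 1] Ev by simp
qed

text \<open>
  A maximiser \<open>v\<close> of the quadratic form on the unit sphere is an eigenvector for the maximal value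
  \<open>l\<close>: the matrix \<open>l I - H\<close> is positive semidefinite and its form vanishes at \<open>v\<close>, so
  \<open>psd_kernel\<close> applies to it. This replaces differentiating the Rayleigh quotient.
\<close>

lemma psd_top_eigenvector:
  fixes H :: "complex^'n^'n"
  assumes psd: "hermitian_psd H" and ne: "H \<noteq> 0"
  obtains v l where "norm v = 1" "0 < l" "H *v v = l *\<^sub>R v"
proof -
  let ?q = "\<lambda>x. inner x (H *v x)"
  have "continuous_on (sphere 0 1) ?q"
    by (intro continuous_intros linear_continuous_on matrix_vector_mul_bounded_linear)
  moreover have "sphere (0::complex^'n) 1 \<noteq> {}"
    by simp
  ultimately obtain v where v: "norm v = 1" and max: "\<And>x. norm x = 1 \<Longrightarrow> ?q x \<le> ?q v"
    using continuous_attains_sup[of "sphere (0::complex^'n) 1" ?q] by auto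
  define l where "l = ?q v"
  have bound: "?q x \<le> l * inner x x" for x
  proof (cases "x = 0")
    case False
    define u where "u = x /\<^sub>R norm x"
    have "norm u = 1" and x: "x = norm x *\<^sub>R u"
      using False by (simp_all add: u_def)
    then have "?q u \<le> l" and "inner u u = 1"
      using max by (simp_all add: l_def power2_norm_eq_inner[symmetric])
    moreover have "?q x = (norm x)\<^sup>2 * ?q u"
      by (subst (1 2) x) (simp add: matrix_vector_scaleR_right power2_eq_square)
    ultimately show ?thesis
      by (simp add: power2_norm_eq_inner[symmetric] mult.commute[of l] mult_left_mono)
  qed simp
  have "hermitian_psd (l *\<^sub>R mat 1 - H)"
    using psd bound by (simp add: hermitian_psd_inner hermitian_diff hermitian_scaleR hermitian_mat_1
        matrix_vector_mult_diff_rdistrib matrix_vector_scaleR_left inner_diff_right)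
  moreover have "inner v ((l *\<^sub>R mat 1 - H) *v v) = 0"
    using v by (simp add: matrix_vector_mult_diff_rdistrib matrix_vector_scaleR_left inner_diff_right
        l_def power2_norm_eq_inner[symmetric])
  ultimately have "(l *\<^sub>R mat 1 - H) *v v = 0"
    by (rule psd_kernel)
  then have eig: "H *v v = l *\<^sub>R v"
    by (simp add: matrix_vector_mult_diff_rdistrib matrix_vector_scaleR_left)
  have "l \<noteq> 0"
  proof
    assume "l = 0"
    then have "?q x = 0" for x
      using bound[of x] psd by (auto simp: hermitian_psd_inner intro: order_antisym)
    then have "H = 0"
      using psd_kernel[OF psd] by (simp add: matrix_eq_0_iff)
    with ne show False ..
  qed
  moreover have "0 \<le> l" using psd by (simp add: l_def hermitian_psd_inner)
  ultimately show thesis using that[OF v _ eig] by simp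
qed

text \<open>
  Peeling off the top eigenvector: with \<open>E = v v\<^sup>*\<close> the matrix \<open>K = H - l E = (I - E) H (I - E)\<close> is
  again positive semidefinite, and its kernel contains \<open>v\<close> in addition to the kernel of \<open>H\<close>. The
  induction is on the real codimension of the kernel.
\<close>

lemma hermitian_psd_induct [consumes 1, case_names zero add]:
  fixes H :: "complex^'n^'n"
  assumes "hermitian_psd H" and zero: "P 0"
    and add: "\<And>(H::complex^'n^'n) l E. \<lbrakk>hermitian_psd H; P H; 0 < l; hermitian E; E ** E = E;
      H ** E = 0; E ** H = 0\<rbrakk> \<Longrightarrow> P (H + l *\<^sub>R E)"
  shows "P H"
  using assms(1)
proof (induction "DIM(complex^'n) - dim {x. H *v x = 0}" arbitrary: H rule: less_induct)
  case less
  show ?case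
  proof (cases "H = 0")
    case True
    then show ?thesis by (simp add: zero)
  next
    case False
    obtain v l where v: "norm v = 1" and l: "0 < l" and Hv: "H *v v = l *\<^sub>R v"
      using psd_top_eigenvector[OF less.prems False] .
    obtain E :: "complex^'n^'n" where herm: "hermitian E" and idem: "E ** E = E" and Ev: "E *v v = v"
      and scale: "\<And>A::complex^'n^'n. \<And>c. A *v v = c *\<^sub>R v \<Longrightarrow> A ** E = c *\<^sub>R E"
      by (rule exists_rank_one_projection[OF v]) (rule that)
    define K where "K = H - l *\<^sub>R E"
    have HE: "H ** E = l *\<^sub>R E" using scale[OF Hv] .
    have EH: "E ** H = l *\<^sub>R E"
      using arg_cong[OF HE, of ctranspose] less.prems herm
      by (simp add: ctranspose_mult ctranspose_scaleR hermitian_psd_def hermitian_def)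
    have KE: "K ** E = 0" and EK: "E ** K = 0"
      by (simp_all add: K_def matrix_diff_rdistrib matrix_diff_ldistrib HE EH
          matrix_mult_scaleR_left matrix_mult_scaleR_right idem)
    define Q where "Q = mat 1 - E"
    have "ctranspose Q ** H ** Q = Q ** (H ** Q)"
      by (simp add: Q_def ctranspose_diff ctranspose_mat_1 hermitian_ctranspose[OF herm] matrix_mul_assoc)
    also have "H ** Q = K" by (simp add: Q_def K_def matrix_diff_ldistrib HE)
    also have "Q ** K = K" by (simp add: Q_def matrix_diff_rdistrib EK)
    finally have K: "hermitian_psd K"
      using hermitian_psd_congruence[OF less.prems, of Q] by simp
    have sub: "subspace {x. A *v x = 0}" for A :: "complex^'n^'n"
      by (auto simp: subspace_def matrix_vector_right_distrib matrix_vector_scaleR_right)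
    have "K *v v = 0"
      by (simp add: K_def matrix_vector_mult_diff_rdistrib matrix_vector_scaleR_left Hv Ev)
    moreover have "H *v v \<noteq> 0" using l v Hv by auto
    moreover have "K *v x = 0" if "H *v x = 0" for x
    proof -
      have "l *\<^sub>R (E *v x) = (E ** H) *v x"
        by (simp add: EH matrix_vector_scaleR_left)
      also have "\<dots> = 0" by (simp add: that flip: matrix_vector_mul_assoc)
      finally show ?thesis
        using that by (simp add: K_def matrix_vector_mult_diff_rdistrib matrix_vector_scaleR_left)
    qed
    ultimately have "{x. H *v x = 0} \<subset> {x. K *v x = 0}" by auto
    then have "dim {x. H *v x = 0} < dim {x. K *v x = 0}"
      by (intro dim_psubset) (simp add: span_eq_iff[THEN iffD2, OF sub])
    moreover have "dim {x. K *v x = 0} \<le> DIM(complex^'n)" by (rule dim_subset_UNIV)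
    ultimately have "P K" by (intro less.hyps[OF _ K] diff_less_mono2) linarith+
    then have "P (K + l *\<^sub>R E)" by (rule add[OF K _ l herm idem KE EK])
    then show ?thesis by (simp add: K_def)
  qed
qed

section \<open>The square root\<close>

text \<open>
  In the induction step, \<open>(S E)\<^sup>* (S E) = E H E = 0\<close>, so \<open>S E = 0\<close> and the mixed terms in the square of \<open>S + \<surd>l E\<close> vanish.
\<close>

lemma psd_sqrt_exists: "\<exists>S. hermitian_psd S \<and> S ** S = H"
  if "hermitian_psd H" for H :: "complex^'n^'n"
  using that
proof (induction rule: hermitian_psd_induct)
  case zero
  show ?case
    by (rule exI[of _ 0]) (simp add: hermitian_psd_inner hermitian_def vec_eq_iff ctranspose_nth)
next
  case (add H l E)
  then obtain S where S: "hermitian_psd S" "S ** S = H" by blast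
  have S': "ctranspose S = S" and E': "ctranspose E = E"
    using S(1) add.hyps by (simp_all add: hermitian_psd_def hermitian_def)
  have "ctranspose (S ** E) ** (S ** E) = E ** (S ** S) ** E"
    by (simp only: ctranspose_mult S' E' matrix_mul_assoc)
  also have "\<dots> = 0" by (simp add: S(2) add.hyps)
  finally have SE: "S ** E = 0" by (rule gram_eq_0)
  have ES: "E ** S = 0"
    using arg_cong[OF SE, of ctranspose] by (simp add: ctranspose_mult S' E' ctranspose_0)
  show ?case
  proof (intro exI conjI)
    show "hermitian_psd (S + sqrt l *\<^sub>R E)"
      using add.hyps by (intro hermitian_psd_add S hermitian_psd_scaleR hermitian_psd_projection) auto
    show "(S + sqrt l *\<^sub>R E) ** (S + sqrt l *\<^sub>R E) = H + l *\<^sub>R E"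
      using add.hyps by (simp add: matrix_add_ldistrib matrix_add_rdistrib matrix_mult_scaleR_left
          matrix_mult_scaleR_right S SE ES)
  qed
qed

text \<open>
  The analogue for matrices of positivity and of \<open>psd_kernel\<close>: if \<open>S = R\<^sup>2\<close>, then
  \<open>\<langle>D, S D\<rangle> = \<parallel>R D\<parallel>\<^sup>2\<close>.
\<close>

lemma psd_inner_mult:
  fixes S D :: "complex^'n^'n"
  assumes "hermitian_psd S"
  shows "0 \<le> inner D (S ** D)" and "inner D (S ** D) = 0 \<Longrightarrow> S ** D = 0"
proof -
  obtain R where R: "hermitian_psd R" "R ** R = S"
    using psd_sqrt_exists[OF assms] by blast
  have eq: "inner D (S ** D) = inner (R ** D) (R ** D)"
    by (simp add: inner_matrix_mult hermitian_ctranspose[OF hermitian_psd_hermitian[OF R(1)]]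
        matrix_mul_assoc R(2))
  show "0 \<le> inner D (S ** D)" by (simp add: eq)
  assume "inner D (S ** D) = 0"
  then have "R ** D = 0" by (simp add: eq)
  then have "R ** (R ** D) = 0" by simp
  then show "S ** D = 0" by (simp add: matrix_mul_assoc R(2))
qed

text \<open>
  The two roots are not known to commute, so \<open>S\<^sup>2 - T\<^sup>2\<close> does not factor as usual, but with
  \<open>D = S - T\<close> it equals \<open>S D + D T\<close>. Pairing this with \<open>D\<close> gives
  \<open>\<langle>D, S D\<rangle> + \<langle>D, T D\<rangle> = 0\<close>, where both terms are nonnegative. Hence \<open>S D = T D = 0\<close> and
  \<open>D\<^sup>* D = (S - T) D = 0\<close>.
\<close>

lemma psd_sqrt_unique:
  fixes S T :: "complex^'n^'n"
  assumes S: "hermitian_psd S" and T: "hermitian_psd T" and eq: "S ** S = T ** T"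
  shows "S = T"
proof -
  define D where "D = S - T"
  have D: "ctranspose D = D" and T': "ctranspose T = T"
    using S T by (simp_all add: D_def ctranspose_diff hermitian_ctranspose hermitian_psd_hermitian)
  have "inner D (D ** T) = inner D (T ** D)"
    using inner_ctranspose[of D "D ** T"] by (simp add: ctranspose_mult D T' inner_commute)
  moreover have "S ** D + D ** T = 0"
    by (simp add: D_def matrix_diff_ldistrib matrix_diff_rdistrib eq)
  then have "inner D (S ** D) + inner D (D ** T) = 0"
    by (simp flip: inner_add_right)
  ultimately have "inner D (S ** D) = 0" "inner D (T ** D) = 0"
    using psd_inner_mult(1)[OF S, of D] psd_inner_mult(1)[OF T, of D] by linarith+
  then have "S ** D = 0" "T ** D = 0"
    using psd_inner_mult(2) S T by blast+
  then have "D ** D = 0" by (simp add: D_def matrix_diff_rdistrib)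
  then have "D = 0" using gram_eq_0[of D] by (simp add: D)
  then show ?thesis by (simp add: D_def)
qed

lemma psd_sqrt:
  assumes "hermitian_psd H"
  shows "hermitian_psd (psd_sqrt H)" and "psd_sqrt H ** psd_sqrt H = H"
proof -
  have "\<exists>!S. hermitian_psd S \<and> S ** S = H"
    using psd_sqrt_exists[OF assms] psd_sqrt_unique by blast
  from theI'[OF this] show "hermitian_psd (psd_sqrt H)" "psd_sqrt H ** psd_sqrt H = H"
    by (simp_all add: psd_sqrt_def)
qed

section \<open>The Moore--Penrose inverse\<close>

text \<open>
  \<open>A X\<close> and \<open>A Y\<close> are Hermitian projections onto the same range, hence equal; \<open>X A\<close> and \<open>Y A\<close>
  are Hermitian projections with the same kernel, hence equal too. Then \<open>X = X A X = Y A Y = Y\<close>.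
\<close>

lemma is_moore_penrose_unique:
  fixes A :: "complex^'n^'m"
  assumes X: "is_moore_penrose A X" and Y: "is_moore_penrose A Y"
  shows "X = Y"
proof -
  have herm: "ctranspose (A ** X) = A ** X" "ctranspose (A ** Y) = A ** Y"
    "ctranspose (X ** A) = X ** A" "ctranspose (Y ** A) = Y ** A"
    and AXA: "A ** X ** A = A" and AYA: "A ** Y ** A = A"
    using X Y by (simp_all add: is_moore_penrose_def hermitian_def)
  have "A ** X = (A ** Y) ** (A ** X)"
    by (simp add: AYA matrix_mul_assoc)
  from arg_cong[OF this, of ctranspose] have "A ** X = (A ** X) ** (A ** Y)"
    by (simp only: ctranspose_mult[of "A ** Y"] herm)
  then have left: "A ** X = A ** Y"
    by (simp add: AXA matrix_mul_assoc)
  have "X ** A = (X ** A) ** (Y ** A)"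
    using arg_cong[OF AYA, of "\<lambda>B. X ** B"] by (simp add: matrix_mul_assoc)
  from arg_cong[OF this, of ctranspose] have "X ** A = (Y ** A) ** (X ** A)"
    by (simp only: ctranspose_mult[of "X ** A"] herm)
  also have "\<dots> = Y ** (A ** X ** A)"
    by (simp only: matrix_mul_assoc)
  finally have right: "X ** A = Y ** A" by (simp only: AXA)
  have "X = X ** (A ** X)" using X by (simp add: is_moore_penrose_def matrix_mul_assoc)
  also have "\<dots> = Y ** (A ** Y)" by (simp add: left right matrix_mul_assoc)
  also have "\<dots> = Y" using Y by (simp add: is_moore_penrose_def matrix_mul_assoc)
  finally show ?thesis .
qed

lemma is_moore_penrose_ctranspose:
  "is_moore_penrose A X \<Longrightarrow> is_moore_penrose (ctranspose A) (ctranspose X)"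
  unfolding is_moore_penrose_def hermitian_def
  by (metis ctranspose_mult ctranspose_ctranspose matrix_mul_assoc)

lemma is_moore_penrose_hermitian:
  "is_moore_penrose A X \<Longrightarrow> hermitian A \<Longrightarrow> hermitian X"
  by (metis is_moore_penrose_ctranspose is_moore_penrose_unique hermitian_def)

text \<open>
  In the induction step \<open>K = H\<^sup>+\<close> is Hermitian and commutes with \<open>H\<close>, so \<open>K = K\<^sup>2 H = H K\<^sup>2\<close>
  inherits \<open>K E = 0\<close> and \<open>E K = 0\<close> from \<open>H\<close>. All mixed products vanish, and \<open>K + l\<^sup>-\<^sup>1 E\<close> is the
  inverse wanted.
\<close>

lemma psd_moore_penrose_exists: "\<exists>X. is_moore_penrose H X"
  if "hermitian_psd H" for H :: "complex^'n^'n"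
  using that
proof (induction rule: hermitian_psd_induct)
  case zero
  show ?case
    by (rule exI[of _ 0]) (simp add: is_moore_penrose_def hermitian_def vec_eq_iff ctranspose_nth)
next
  case (add H l E)
  then obtain K where K: "is_moore_penrose H K" by blast
  have "hermitian K"
    using is_moore_penrose_hermitian[OF K] add.hyps by (simp add: hermitian_psd_def)
  then have K': "ctranspose K = K" and H': "ctranspose H = H"
    using add.hyps(1) by (simp_all add: hermitian_psd_def hermitian_def)
  have HKH: "H ** K ** H = H" and KHK: "K ** H ** K = K"
    and herm: "hermitian (H ** K)" "hermitian (K ** H)"
    using K by (simp_all add: is_moore_penrose_def)
  have KH: "K ** H = H ** K"
    using hermitian_ctranspose[OF herm(1)] by (simp only: ctranspose_mult K' H')
  have "K ** E = K ** (K ** H) ** E"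
    by (simp only: KH) (simp only: matrix_mul_assoc KHK)
  then have KE: "K ** E = 0"
    by (simp add: add.hyps flip: matrix_mul_assoc)
  have "E ** K = E ** (H ** K) ** K"
    by (simp only: KH[symmetric] KHK flip: matrix_mul_assoc[of E])
  then have EK: "E ** K = 0"
    by (simp add: add.hyps matrix_mul_assoc)
  have l: "inverse l * l = 1" "l * inverse l = 1"
    using \<open>0 < l\<close> by simp_all
  note expand = matrix_add_ldistrib matrix_add_rdistrib matrix_mult_scaleR_left
    matrix_mult_scaleR_right KE EK add.hyps
  have HK: "(H + l *\<^sub>R E) ** (K + inverse l *\<^sub>R E) = H ** K + E"
    by (simp add: expand l)
  have KH': "(K + inverse l *\<^sub>R E) ** (H + l *\<^sub>R E) = K ** H + E"
    by (simp add: expand l)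
  have "is_moore_penrose (H + l *\<^sub>R E) (K + inverse l *\<^sub>R E)"
    unfolding is_moore_penrose_def HK KH'
  proof (intro conjI)
    have "H ** K ** E = 0" "K ** H ** E = 0"
      by (simp_all add: KE add.hyps flip: matrix_mul_assoc)
    moreover have "E ** (H ** K) = 0" "E ** (K ** H) = 0"
      by (simp_all add: EK add.hyps matrix_mul_assoc)
    ultimately show "(H ** K + E) ** (H + l *\<^sub>R E) = H + l *\<^sub>R E"
      and "(K ** H + E) ** (K + inverse l *\<^sub>R E) = K + inverse l *\<^sub>R E"
      by (simp_all add: expand HKH KHK)
    show "hermitian (H ** K + E)" "hermitian (K ** H + E)"
      by (intro hermitian_add herm add.hyps)+
  qed
  then show ?case ..
qed

lemma psd_pinv:
  fixes H :: "complex^'n^'n"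
  assumes "hermitian_psd H"
  shows "is_moore_penrose H (pinv H)"
proof -
  have "\<exists>!X. is_moore_penrose H X"
    using psd_moore_penrose_exists[OF assms] is_moore_penrose_unique by blast
  from theI'[OF this] show ?thesis by (simp add: pinv_def)
qed

lemma psd_pinv_hermitian: "hermitian_psd H \<Longrightarrow> hermitian (pinv H)"
  using is_moore_penrose_hermitian psd_pinv hermitian_psd_hermitian by blast

section \<open>The least-squares problem\<close>

text \<open>
  With \<open>M = A\<^sup>* A\<close> the columns of \<open>Z = M\<^sup>+ M - I\<close> lie in the kernel of \<open>M\<close>, which is the kernel
  of \<open>A\<close>. Reassociated, the identity says that \<open>A M\<^sup>+ A\<^sup>*\<close> fixes the range of \<open>A\<close>.
\<close>

lemma gram_pinv_absorb:
  fixes A :: "complex^'r^'n"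
  shows "A ** pinv (ctranspose A ** A) ** (ctranspose A ** A) = A"
proof -
  define M where "M = ctranspose A ** A"
  define Z where "Z = pinv M ** M - mat 1"
  have "M ** pinv M ** M = M"
    using psd_pinv[OF hermitian_psd_gram[of A]] by (simp add: is_moore_penrose_def M_def)
  then have "M ** Z = 0"
    by (simp add: Z_def matrix_diff_ldistrib matrix_mul_assoc)
  then have "ctranspose (A ** Z) ** (A ** Z) = 0"
    by (simp add: ctranspose_mult M_def flip: matrix_mul_assoc)
  then have "A ** Z = 0" by (rule gram_eq_0)
  then show ?thesis
    by (simp add: Z_def matrix_diff_ldistrib matrix_mul_assoc M_def)
qed

text \<open>
  The hypothesis \<open>G A = A\<close> makes the residual \<open>R = G - A X\<^sub>s A\<^sup>*\<close> satisfy \<open>R A = 0\<close>; as \<open>R\<close> is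
  Hermitian, also \<open>A\<^sup>* R = 0\<close>, so \<open>R\<close> is orthogonal to every \<open>A Z A\<^sup>*\<close>.
\<close>

lemma gram_least_squares:
  fixes A :: "complex^'r^'n" and G :: "complex^'n^'n" and X :: "complex^'r^'r"
  assumes GA: "G ** A = A" and G: "hermitian G"
  defines "Xs \<equiv> pinv (ctranspose A ** A)"
  shows "(norm (G - A ** X ** ctranspose A))\<^sup>2
    = (norm (G - A ** Xs ** ctranspose A))\<^sup>2 + (norm (A ** (Xs - X) ** ctranspose A))\<^sup>2"
proof -
  define R where "R = G - A ** Xs ** ctranspose A"
  define W where "W = A ** (Xs - X) ** ctranspose A"
  have "A ** Xs ** ctranspose A ** A = A"
    using gram_pinv_absorb[of A] by (simp add: Xs_def matrix_mul_assoc)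
  then have "R ** A = 0"
    by (simp add: R_def matrix_diff_rdistrib GA)
  moreover have "ctranspose R = R"
    using G psd_pinv_hermitian[OF hermitian_psd_gram[of A]]
    by (simp add: R_def Xs_def ctranspose_diff ctranspose_mult ctranspose_ctranspose
        hermitian_ctranspose matrix_mul_assoc)
  ultimately have "ctranspose A ** R = 0"
    by (metis ctranspose_mult ctranspose_0)
  then have "inner W R = 0"
    by (simp add: W_def inner_matrix_mult flip: matrix_mul_assoc)
  moreover have "G - A ** X ** ctranspose A = R + W"
    by (simp add: R_def W_def matrix_diff_ldistrib matrix_diff_rdistrib)
  ultimately show ?thesis
    by (simp add: R_def[symmetric] W_def[symmetric] power2_norm_eq_inner inner_add_left
        inner_add_right inner_commute)
qed

text \<open>
  Both factors \<open>S\<^sup>+\<close> are absorbed: \<open>S\<^sup>+ H S\<^sup>+ = (S\<^sup>+ S) (S S\<^sup>+) = G\<close>, and \<open>S\<^sup>+ (H \<Omega>) = S\<^sup>+ S S \<Omega> = S \<Omega>\<close>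
  because \<open>S\<^sup>+ S = S S\<^sup>+\<close>.
\<close>

lemma nystrom_objective_eq:
  fixes H :: "complex^'n^'n" and \<Omega> :: "complex^'r^'n"
  assumes "hermitian_psd H"
  defines "A \<equiv> psd_sqrt H ** \<Omega>" and "G \<equiv> psd_sqrt H ** pinv (psd_sqrt H)"
  shows "nystrom_objective H (H ** \<Omega>) X = (norm (G - A ** X ** ctranspose A))\<^sup>2"
    and "G ** A = A" and "hermitian G" and "ctranspose A ** A = ctranspose \<Omega> ** H ** \<Omega>"
proof -
  define S where "S = psd_sqrt H"
  define P where "P = pinv S"
  have S: "hermitian_psd S" and SS: "S ** S = H"
    using psd_sqrt[OF assms(1)] by (simp_all add: S_def)
  have P: "is_moore_penrose S P" using psd_pinv[OF S] by (simp add: P_def)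
  have S': "ctranspose S = S" and P': "ctranspose P = P"
    using S psd_pinv_hermitian[OF S] by (simp_all add: P_def hermitian_psd_def hermitian_def)
  have G_def': "G = S ** P" and A_def': "A = S ** \<Omega>"
    by (simp_all add: G_def A_def P_def S_def)
  show G: "hermitian G" using P by (simp add: G_def' is_moore_penrose_def)
  have comm: "P ** S = G"
    using G by (metis G_def' S' P' ctranspose_mult hermitian_def)
  have SPS: "S ** P ** S = S" using P by (simp add: is_moore_penrose_def)
  have GA: "G ** A = A"
    by (simp add: G_def' A_def' SPS matrix_mul_assoc)
  then show "G ** A = A" .
  have PY: "P ** (H ** \<Omega>) = A"
  proof -
    have "P ** (H ** \<Omega>) = P ** S ** S ** \<Omega>" by (simp add: matrix_mul_assoc flip: SS)
    also have "\<dots> = A" by (simp add: comm G_def' SPS A_def')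
    finally show ?thesis .
  qed
  then have YP: "ctranspose (H ** \<Omega>) ** P = ctranspose A"
    by (metis P' ctranspose_mult)
  have "P ** H ** P = (P ** S) ** (S ** P)"
    by (simp add: matrix_mul_assoc flip: SS)
  also have "\<dots> = G" by (simp add: comm G_def' SPS matrix_mul_assoc)
  finally have PHP: "P ** H ** P = G" .
  have "P ** (H - (H ** \<Omega>) ** X ** ctranspose (H ** \<Omega>)) ** P
      = P ** H ** P - (P ** (H ** \<Omega>)) ** X ** (ctranspose (H ** \<Omega>) ** P)"
    by (simp only: matrix_diff_ldistrib matrix_diff_rdistrib matrix_mul_assoc)
  then show "nystrom_objective H (H ** \<Omega>) X = (norm (G - A ** X ** ctranspose A))\<^sup>2"
    by (simp only: nystrom_objective_def frobenius_norm_eq_norm PY YP PHP flip: P_def S_def)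
  show "ctranspose A ** A = ctranspose \<Omega> ** H ** \<Omega>"
    by (simp add: A_def' ctranspose_mult S' matrix_mul_assoc flip: SS)
qed

theorem proposition4:
  fixes H :: "complex^'n^'n" and \<Omega>\<^sub>R :: "real^'r^'n"
    and \<Omega> Y :: "complex^'r^'n" and X\<^sub>s :: "complex^'r^'r"
  assumes psd: "hermitian_psd H"
    and full_rank: "rank \<Omega>\<^sub>R = min CARD('n) CARD('r)"
    and Omega: "\<Omega> = complex_matrix \<Omega>\<^sub>R"
    and Y: "Y = H ** \<Omega>"
    and Xs: "X\<^sub>s = pinv (ctranspose \<Omega> ** H ** \<Omega>)"
  shows "nystrom H \<Omega> = Y ** X\<^sub>s ** ctranspose Y
    \<and> is_arg_min (nystrom_objective H Y) hermitian X\<^sub>s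
    \<and> (invertible (ctranspose \<Omega> ** H ** \<Omega>) \<longrightarrow>
         (\<forall>X. is_arg_min (nystrom_objective H Y) hermitian X \<longrightarrow> X = X\<^sub>s))"
proof (intro conjI impI allI)
  define A where "A = psd_sqrt H ** \<Omega>"
  define M where "M = ctranspose \<Omega> ** H ** \<Omega>"
  define G where "G = psd_sqrt H ** pinv (psd_sqrt H)"
  have objective: "nystrom_objective H Y X = (norm (G - A ** X ** ctranspose A))\<^sup>2" for X
    using nystrom_objective_eq(1)[OF psd] by (simp add: Y A_def G_def)
  have GA: "G ** A = A" and G: "hermitian G"
    using nystrom_objective_eq(2,3)[OF psd] by (simp_all add: A_def G_def)
  have AA: "ctranspose A ** A = M"
    using nystrom_objective_eq(4)[OF psd] by (simp add: A_def M_def)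
  have XsM: "X\<^sub>s = pinv M" by (simp add: Xs M_def)
  have M: "hermitian_psd M" unfolding AA[symmetric] by (rule hermitian_psd_gram)
  have herm: "hermitian X\<^sub>s" unfolding XsM by (rule psd_pinv_hermitian[OF M])
  have split: "nystrom_objective H Y X
      = nystrom_objective H Y X\<^sub>s + (norm (A ** (X\<^sub>s - X) ** ctranspose A))\<^sup>2" for X
    unfolding objective gram_least_squares[OF GA G, of X] AA XsM ..
  show "nystrom H \<Omega> = Y ** X\<^sub>s ** ctranspose Y"
    by (simp add: nystrom_def Y Xs)
  show "is_arg_min (nystrom_objective H Y) hermitian X\<^sub>s"
    unfolding is_arg_min_def
  proof (intro conjI notI)
    assume "\<exists>X. hermitian X \<and> nystrom_objective H Y X < nystrom_objective H Y X\<^sub>s"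
    then obtain X where "nystrom_objective H Y X < nystrom_objective H Y X\<^sub>s" by blast
    then show False by (simp add: split[of X])
  qed (rule herm)
  fix X
  assume inv: "invertible (ctranspose \<Omega> ** H ** \<Omega>)"
    and "is_arg_min (nystrom_objective H Y) hermitian X"
  then have "nystrom_objective H Y X \<le> nystrom_objective H Y X\<^sub>s"
    using herm by (auto simp: is_arg_min_def not_less)
  then have "A ** (X\<^sub>s - X) ** ctranspose A = 0"
    using split[of X] by simp
  \<comment> \<open>Multiplying by \<open>A\<^sup>*\<close> and \<open>A\<close> turns both factors into the invertible Gram matrix.\<close>
  then have "ctranspose A ** (A ** (X\<^sub>s - X) ** ctranspose A) ** A = 0" by simp
  then have MZM: "M ** (X\<^sub>s - X) ** M = 0"
    by (metis AA matrix_mul_assoc)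
  obtain N where N: "M ** N = mat 1" "N ** M = mat 1"
    using inv unfolding invertible_def M_def by blast
  have "X\<^sub>s - X = (N ** M) ** (X\<^sub>s - X) ** (M ** N)" by (simp add: N)
  also have "\<dots> = N ** (M ** (X\<^sub>s - X) ** M) ** N" by (simp only: matrix_mul_assoc)
  finally show "X = X\<^sub>s" by (simp add: MZM)
qed

end
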